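(* Let $X$ be a complex curve (one-dimensional complex manifold), let $p\in X$, $D=\{p\}$, and let $f:(X,D)\to(X,D)$ be a strict logarithmic self-map. Choose a coordinate $z$ centred at $p$ and write $f(z)=z\,a(z)$ with $a(0)\ne0$. If $p$ is an isolated fixed point of $f$, then $$\operatorname{Ind}^{\mathrm{dR},\log}_{p,D}(f)=\operatorname{ord}_p(1-a).$$
   Context: Strict means $f^{-1}\mathcal I_D\cdot\mathcal O_X=\mathcal I_D$, i.e. $f(z)=z\,a(z)$ near $p$ with $a(0)\neq0$ (and $f^{-1}(p)=p$ as divisors). $J_f^{\log}$ is the endomorphism of the logarithmic cotangent line $\Omega_X^1(\log D)$ (generated by $\mathrm dz/z$) restricted to the fixed-point scheme of $f$, induced by pull-back: $f^*(\mathrm dz/z)=\mathrm dz/z+\mathrm da/a$. The logarithmic de Rham index is the Grothendieck residue $$\operatorname{Ind}^{\mathrm{dR},\log}_{p,D}(f)=\operatorname{Res}_p\left[\frac{(1-J_f^{\log})\,\mathrm dz}{z-f(z)}\right]$$ (the value at $y=-1$, with trivial coefficient bundle, of the boundary index $\operatorname{Res}_p\left[\frac{(1+yJ_f^{\log})\,\mathrm dz}{z-f(z)}\right]$). $\operatorname{ord}_p$ denotes the order of vanishing at $p$. *)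

theory Defs
  imports "HOL-Complex_Analysis.Complex_Analysis"
begin

section \<open>Complex curves\<close>

text \<open>A complex curve is a Hausdorff, second countable space (the type \<open>'a\<close>) together with a
  holomorphic atlas, which need not be maximal.\<close>

type_synonym 'a atlas = "('a set \<times> ('a \<Rightarrow> complex)) set"

definition chart :: "'a::topological_space set \<Rightarrow> ('a \<Rightarrow> complex) \<Rightarrow> bool" where
  "chart U \<phi> \<longleftrightarrow> open U \<and> open (\<phi> ` U) \<and> homeomorphism U (\<phi> ` U) \<phi> (inv_into U \<phi>)"

definition compatible ::
    "'a set \<Rightarrow> ('a \<Rightarrow> complex) \<Rightarrow> 'a set \<Rightarrow> ('a \<Rightarrow> complex) \<Rightarrow> bool" where
  "compatible U \<phi> V \<psi> \<longleftrightarrow>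
     (\<psi> \<circ> inv_into U \<phi>) holomorphic_on \<phi> ` (U \<inter> V) \<and>
     (\<phi> \<circ> inv_into V \<psi>) holomorphic_on \<psi> ` (U \<inter> V)"

definition complex_curve :: "('a::{t2_space, second_countable_topology}) atlas \<Rightarrow> bool" where
  "complex_curve A \<longleftrightarrow>
     (\<forall>(U, \<phi>) \<in> A. chart U \<phi>) \<and>
     (\<Union>(U, \<phi>) \<in> A. U) = UNIV \<and>
     (\<forall>(U, \<phi>) \<in> A. \<forall>(V, \<psi>) \<in> A. compatible U \<phi> V \<psi>)"

text \<open>A coordinate centred at \<open>p\<close> is any chart of the maximal atlas around \<open>p\<close> sending
  \<open>p\<close> to \<open>0\<close>.\<close>

definition coordinate_at :: "'a::topological_space atlas \<Rightarrow> 'a \<Rightarrow> 'a set \<Rightarrow> ('a \<Rightarrow> complex) \<Rightarrow> bool" where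
  "coordinate_at A p U z \<longleftrightarrow>
     chart U z \<and> (\<forall>(V, \<psi>) \<in> A. compatible U z V \<psi>) \<and> p \<in> U \<and> z p = 0"

definition holomorphic_self_map :: "'a::topological_space atlas \<Rightarrow> ('a \<Rightarrow> 'a) \<Rightarrow> bool" where
  "holomorphic_self_map A f \<longleftrightarrow>
     continuous_on UNIV f \<and>
     (\<forall>(U, \<phi>) \<in> A. \<forall>(V, \<psi>) \<in> A.
        (\<psi> \<circ> f \<circ> inv_into U \<phi>) holomorphic_on \<phi> ` (U \<inter> f -` V))"

text \<open>Germs of functions at a point are represented by total functions, of which only the
  behaviour near the point matters.\<close>

definition holomorphic_at :: "'a atlas \<Rightarrow> 'a \<Rightarrow> ('a \<Rightarrow> complex) \<Rightarrow> bool" where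
  "holomorphic_at A x h \<longleftrightarrow>
     (\<forall>(U, \<phi>) \<in> A. x \<in> U \<longrightarrow> (h \<circ> inv_into U \<phi>) analytic_on {\<phi> x})"

definition isolated_fixed_point :: "('a::topological_space \<Rightarrow> 'a) \<Rightarrow> 'a \<Rightarrow> bool" where
  "isolated_fixed_point f p \<longleftrightarrow> f p = p \<and> (\<forall>\<^sub>F x in at p. f x \<noteq> x)"


section \<open>Strict logarithmic self-maps\<close>

text \<open>The stalk at \<open>x\<close> of the ideal sheaf of a reduced divisor \<open>D\<close>.\<close>

definition divisor_ideal :: "'a atlas \<Rightarrow> 'a set \<Rightarrow> 'a \<Rightarrow> ('a \<Rightarrow> complex) set" where
  "divisor_ideal A D x = {h. holomorphic_at A x h \<and> (x \<in> D \<longrightarrow> h x = 0)}"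

text \<open>The stalk at \<open>x\<close> of \<open>f\<inverse> I\<^sub>D \<cdot> O\<^sub>X\<close>.\<close>

definition inverse_image_ideal ::
    "'a::topological_space atlas \<Rightarrow> 'a set \<Rightarrow> ('a \<Rightarrow> 'a) \<Rightarrow> 'a \<Rightarrow> ('a \<Rightarrow> complex) set" where
  "inverse_image_ideal A D f x =
     {h. \<exists>(n::nat) u g.
           (\<forall>i<n. holomorphic_at A x (u i) \<and> g i \<in> divisor_ideal A D (f x)) \<and>
           (\<forall>\<^sub>F y in nhds x. h y = (\<Sum>i<n. u i y * g i (f y)))}"

definition strict_log_self_map :: "'a::topological_space atlas \<Rightarrow> 'a set \<Rightarrow> ('a \<Rightarrow> 'a) \<Rightarrow> bool" where
  "strict_log_self_map A D f \<longleftrightarrow>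
     holomorphic_self_map A f \<and> (\<forall>x. inverse_image_ideal A D f x = divisor_ideal A D x)"


section \<open>The logarithmic de Rham index\<close>

definition in_coordinate :: "'a set \<Rightarrow> ('a \<Rightarrow> complex) \<Rightarrow> ('a \<Rightarrow> 'a) \<Rightarrow> complex \<Rightarrow> complex" where
  "in_coordinate U z f = z \<circ> f \<circ> inv_into U z"

text \<open>In the following, \<open>F\<close> is a self-map of a neighbourhood of \<open>0\<close> in the complex plane,
  with \<open>F 0 = 0\<close>. The ideal of its fixed-point scheme at \<open>0\<close> is generated by \<open>w - F w\<close>.\<close>

definition fixed_point_ideal :: "(complex \<Rightarrow> complex) \<Rightarrow> (complex \<Rightarrow> complex) set" where
  "fixed_point_ideal F =
     {k. \<exists>q. q analytic_on {0} \<and> (\<forall>\<^sub>F w in nhds 0. k w = (w - F w) * q w)}"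

text \<open>\<open>J\<close> represents the endomorphism induced by pull-back on the restriction to the fixed-point
  scheme of the line generated by \<open>dw / w\<close>: for every logarithmic form \<open>h dw / w\<close>, the pull-back
  \<open>h (F w) F' w dw / F w\<close> equals \<open>J h dw / w\<close> modulo the ideal of the fixed-point scheme.
  Thus \<open>J\<close> is only determined modulo that ideal.\<close>

definition log_jacobian :: "(complex \<Rightarrow> complex) \<Rightarrow> (complex \<Rightarrow> complex) \<Rightarrow> bool" where
  "log_jacobian F J \<longleftrightarrow>
     J analytic_on {0} \<and>
     (\<forall>h. h analytic_on {0} \<longrightarrow>
        (\<exists>k \<in> fixed_point_ideal F.
           \<forall>\<^sub>F w in at 0. h (F w) * deriv F w / F w = (J w * h w + k w) / w))"

text \<open>The one-variable Grothendieck residue symbol of \<open>h dw\<close> over \<open>g\<close> at \<open>0\<close>.\<close>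

definition grothendieck_residue :: "(complex \<Rightarrow> complex) \<Rightarrow> (complex \<Rightarrow> complex) \<Rightarrow> complex" where
  "grothendieck_residue h g = residue (\<lambda>w. h w / g w) 0"

text \<open>The common value of the residue over all coordinates centred at \<open>p\<close> and all
  representatives \<open>J\<close>.\<close>

definition dR_log_index :: "'a::topological_space atlas \<Rightarrow> 'a \<Rightarrow> ('a \<Rightarrow> 'a) \<Rightarrow> complex" where
  "dR_log_index A p f =
     (THE r. \<exists>U z J. coordinate_at A p U z \<and> log_jacobian (in_coordinate U z f) J \<and>
        r = grothendieck_residue (\<lambda>w. 1 - J w) (\<lambda>w. w - in_coordinate U z f w))"

end

theory Submission
  imports Defs
begin

text \<open>In a coordinate, a representative of the Jacobian is \<open>J = 1 + w a' / a - (w - F w) q\<close> with \<open>q\<close>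
  holomorphic, and \<open>w - F w = w b\<close> with \<open>b = 1 - a\<close>. Since \<open>1 / (a b) = 1 / a + 1 / b\<close>, the form
  \<open>(1 - J) dw / (w - F w)\<close> is \<open>b' / b dw\<close> up to a holomorphic form, so that its residue is the
  order of \<open>b\<close>. Under a change of coordinate \<open>T\<close>, the function \<open>T w - T (F w)\<close> is \<open>w - F w\<close> times a
  unit (a divided difference of \<open>T\<close>), which leaves this order unchanged.\<close>

section \<open>Divided differences and logarithmic derivatives of analytic germs\<close>

text \<open>Both points of the difference quotient move, so differentiability at \<open>c\<close>
  alone does not suffice. Since \<open>deriv h\<close> is continuous, \<open>h\<close> minus its
  linear part has derivative of norm at most \<open>e / 2\<close> on a small ball, and is
  \<open>e / 2\<close>-Lipschitz there by the mean value inequality.\<close>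

lemma tendsto_divided_difference:
  fixes h :: "complex \<Rightarrow> complex"
  assumes h: "h analytic_on {c}" and f: "(f \<longlongrightarrow> c) \<F>" and g: "(g \<longlongrightarrow> c) \<F>"
    and neq: "\<forall>\<^sub>F x in \<F>. f x \<noteq> g x"
  shows "((\<lambda>x. (h (f x) - h (g x)) / (f x - g x)) \<longlongrightarrow> deriv h c) \<F>"
proof (rule tendstoI)
  fix e :: real
  assume e: "e > 0"
  obtain r where r: "r > 0" "h holomorphic_on ball c r"
    using h by (auto simp: analytic_at_ball)
  have "isCont (deriv h) c"
    using h by (intro analytic_at_imp_isCont analytic_deriv)
  then obtain d where d: "d > 0" "\<And>x. dist x c < d \<Longrightarrow> dist (deriv h x) (deriv h c) < e / 2"
    using e unfolding continuous_at_eps_delta by (metis half_gt_zero)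
  \<comment> \<open>The mean value inequality needs a convex set; on this ball \<open>h\<close> is
    holomorphic and \<open>deriv h\<close> is close to its value at \<open>c\<close>.\<close>
  define S where "S = ball c (min r d)"
  have S: "open S" "c \<in> S" "convex S"
    using r d by (auto simp: S_def)
  have bound: "norm ((h x - deriv h c * x) - (h y - deriv h c * y)) \<le> e / 2 * norm (x - y)"
    if "x \<in> S" "y \<in> S" for x y
  proof (rule field_differentiable_bound[OF \<open>convex S\<close> _ _ that])
    fix u assume u: "u \<in> S"
    have "(h has_field_derivative deriv h u) (at u)"
      using u r by (intro holomorphic_derivI[of h "ball c r"]) (auto simp: S_def)
    then show "((\<lambda>x. h x - deriv h c * x) has_field_derivative deriv h u - deriv h c) (at u within S)"
      by (auto intro!: derivative_eq_intros intro: has_field_derivative_at_within)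
    show "norm (deriv h u - deriv h c) \<le> e / 2"
      using d(2)[of u] u by (simp add: S_def dist_norm dist_commute norm_minus_commute less_imp_le)
  qed
  have "\<forall>\<^sub>F x in \<F>. f x \<in> S" "\<forall>\<^sub>F x in \<F>. g x \<in> S"
    using topological_tendstoD[OF f S(1,2)] topological_tendstoD[OF g S(1,2)] by auto
  then show "\<forall>\<^sub>F x in \<F>. dist ((h (f x) - h (g x)) / (f x - g x)) (deriv h c) < e"
    using neq
  proof eventually_elim
    case (elim x)
    have "(h (f x) - h (g x)) / (f x - g x) - deriv h c
        = ((h (f x) - deriv h c * f x) - (h (g x) - deriv h c * g x)) / (f x - g x)"
      using elim by (simp add: field_simps)
    also have "norm \<dots> \<le> e / 2"
      using bound[OF elim(1,2)] elim(3) by (simp add: norm_divide divide_le_eq)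
    finally show ?case
      using e by (simp add: dist_norm)
  qed
qed

text \<open>The quotient has a removable singularity at \<open>0\<close>, with limit
  \<open>deriv h 0\<close>. For the self-map \<open>F\<close> this puts \<open>h - h o F\<close> in
  the fixed-point ideal; for the zero map it divides a function vanishing at \<open>0\<close> by the
  coordinate.\<close>

lemma divided_difference:
  fixes h F :: "complex \<Rightarrow> complex"
  assumes h: "h analytic_on {0}" and F: "F analytic_on {0}" "F 0 = 0"
    and neq: "\<forall>\<^sub>F w in at 0. F w \<noteq> w"
  obtains q where "q analytic_on {0}" "q 0 = deriv h 0"
    "\<forall>\<^sub>F w in nhds 0. h w - h (F w) = (w - F w) * q w"
proof -
  let ?q = "\<lambda>w. (h w - h (F w)) / (w - F w)"
  define q where "q = (\<lambda>w. if w = 0 then deriv h 0 else ?q w)"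
  have "F \<midarrow>0\<rightarrow> 0"
    using analytic_at_imp_isCont[OF F(1)] F(2) by (simp add: isCont_def)
  then have lim: "?q \<midarrow>0\<rightarrow> deriv h 0"
    using neq by (intro tendsto_divided_difference[OF h]) (auto elim: eventually_mono)
  have hF: "(\<lambda>w. h (F w)) analytic_on {0}"
    using analytic_on_compose_gen[of F "{0}" h "{0}"] F h by (auto simp: o_def)
  have "isolated_singularity_at ?q 0"
    using neq by (intro singularity_intros isolated_singularity_at_analytic analytic_intros h hF F
        not_essential_analytic)
  then have "q analytic_on {0}"
    unfolding q_def using lim by (rule removable_singularity')
  moreover have "\<forall>\<^sub>F w in nhds 0. h w - h (F w) = (w - F w) * q w"
    using neq unfolding eventually_at_filter
    by eventually_elim (auto simp: q_def F)
  ultimately show thesis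
    using that[of q] by (simp add: q_def)
qed

text \<open>With \<open>b w = g w * w powi n\<close> and \<open>g 0\<close> nonzero, the logarithmic
  derivative is \<open>g' / g + n / w\<close>. The limit is later read as the residue at a simple
  pole.\<close>

lemma tendsto_logderiv_zorder:
  fixes b :: "complex \<Rightarrow> complex"
  assumes b: "b analytic_on {0}" and nz: "\<forall>\<^sub>F w in at 0. b w \<noteq> 0"
  shows "(\<lambda>w. w * deriv b w / b w) \<midarrow>0\<rightarrow> of_int (zorder b 0)"
proof -
  define n where "n = zorder b 0"
  define g where "g = zor_poly b 0"
  have "isolated_singularity_at b 0" "not_essential b 0" "\<exists>\<^sub>F w in at 0. b w \<noteq> 0"
    using b nz by (auto intro: isolated_singularity_at_analytic not_essential_analytic
        eventually_frequently)
  from zorder_exist[OF this]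
  obtain r where r: "r > 0" "g 0 \<noteq> 0" "g holomorphic_on cball 0 r"
    "\<forall>w\<in>cball 0 r - {0}. b w = g w * w powi n \<and> g w \<noteq> 0"
    unfolding n_def g_def by auto
  have g: "g analytic_on {0}"
    using r by (auto simp: analytic_at intro!: exI[of _ "ball 0 r"] holomorphic_on_subset[OF r(3)])
  have "(\<lambda>w. w * deriv g w / g w + of_int n) \<midarrow>0\<rightarrow> 0 * deriv g 0 / g 0 + of_int n"
    using g r by (intro tendsto_intros isContD[OF analytic_at_imp_isCont] analytic_deriv) auto
  moreover have "\<forall>\<^sub>F w in at 0. w * deriv g w / g w + of_int n = w * deriv b w / b w"
  proof -
    have "\<forall>\<^sub>F w in at 0. w \<in> ball 0 r - {0}"
      using r by (intro eventually_at_in_open) auto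
    then show ?thesis
    proof eventually_elim
      case (elim w)
      have "deriv b w = deriv (\<lambda>w. g w * w powi n) w"
        using elim r(4) by (intro deriv_cong_ev eventually_mono[OF
              eventually_nhds_in_open[of "ball 0 r - {0}" w]]) auto
      also have "\<dots> = deriv g w * w powi n + g w * (of_int n * w powi (n - 1))"
      proof -
        have "(g has_field_derivative deriv g w) (at w)"
          using elim holomorphic_on_subset[OF r(3) ball_subset_cball]
          by (auto intro: holomorphic_derivI[of g "ball 0 r"])
        then show ?thesis
          using elim by (intro DERIV_imp_deriv) (auto intro!: derivative_eq_intros)
      qed
      finally show ?case
        using elim r(4) by (auto simp: field_simps power_int_diff)
    qed
  qed
  ultimately show ?thesis
    unfolding n_def by (simp add: Lim_transform_eventually)
qed

section \<open>The Jacobian and its residue in one coordinate\<close>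

lemma deriv_factored:
  fixes F a :: "complex \<Rightarrow> complex"
  assumes a: "a analytic_on {0}" and F: "\<forall>\<^sub>F w in nhds 0. F w = w * a w"
  shows "\<forall>\<^sub>F w in nhds 0. deriv F w = a w + w * deriv a w"
proof -
  obtain S where S: "open S" "0 \<in> S" "a holomorphic_on S"
    using a by (auto simp: analytic_at)
  have "\<forall>\<^sub>F w in nhds 0. w \<in> S"
    using S by (intro eventually_nhds_in_open)
  \<comment> \<open>The value of \<open>deriv F\<close> at \<open>w\<close> depends on the germ of
    \<open>F\<close> at \<open>w\<close>, so the factorization has to hold around every nearby
    point.\<close>
  moreover have "\<forall>\<^sub>F w in nhds 0. \<forall>\<^sub>F v in nhds w. F v = v * a v"
    using F by (simp add: eventually_eventually)
  ultimately show ?thesis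
  proof eventually_elim
    case (elim w)
    then have "deriv F w = deriv (\<lambda>v. v * a v) w"
      by (intro deriv_cong_ev) auto
    also have "\<dots> = a w + w * deriv a w"
      using elim S by (intro DERIV_imp_deriv)
        (auto intro!: derivative_eq_intros holomorphic_derivI[of a S])
    finally show ?case .
  qed
qed

lemma eventually_analytic_nonzero:
  fixes a :: "complex \<Rightarrow> complex"
  assumes "a analytic_on {c}" "a c \<noteq> 0"
  shows "\<forall>\<^sub>F w in nhds c. a w \<noteq> 0"
proof -
  have "(a \<longlongrightarrow> a c) (at c)"
    using analytic_at_imp_isCont[OF assms(1)] by (simp add: isCont_def)
  then have "\<forall>\<^sub>F w in at c. a w \<noteq> 0"
    using assms(2) by (rule tendsto_imp_eventually_ne)
  then show ?thesis
    using assms(2) by (simp add: eventually_nhds_conv_at)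
qed

text \<open>From \<open>F w = w * a w\<close> one gets \<open>deriv F w / F w = ?J w / w\<close>,
  which settles \<open>h = 1\<close>. For general \<open>h\<close>, replacing \<open>h (F w)\<close>
  by \<open>h w\<close> costs an element of the fixed-point ideal.\<close>

lemma log_jacobian_exists:
  assumes a: "a analytic_on {0}" "a 0 \<noteq> 0"
    and F: "\<forall>\<^sub>F w in nhds 0. F w = w * a w" and neq: "\<forall>\<^sub>F w in at 0. F w \<noteq> w"
  shows "log_jacobian F (\<lambda>w. 1 + w * deriv a w / a w)" (is "log_jacobian F ?J")
  unfolding log_jacobian_def
proof (intro conjI allI impI)
  show J: "?J analytic_on {0}"
    using a by (intro analytic_intros analytic_deriv) auto
  fix h :: "complex \<Rightarrow> complex"
  assume h: "h analytic_on {0}"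
  have F': "F analytic_on {0}"
    using a F by (subst analytic_at_cong[OF F refl]) (intro analytic_intros)
  have F0: "F 0 = 0"
    using eventually_nhds_x_imp_x[OF F] by simp
  obtain q where q: "q analytic_on {0}"
    "\<forall>\<^sub>F w in nhds 0. h w - h (F w) = (w - F w) * q w"
    using divided_difference[OF h F' F0 neq] by metis
  \<comment> \<open>The error term: \<open>?J w\<close> times \<open>h (F w) - h w\<close>.\<close>
  define k where "k = (\<lambda>w. (w - F w) * (- q w * ?J w))"
  have "k \<in> fixed_point_ideal F"
    unfolding fixed_point_ideal_def k_def using q J
    by (auto intro!: exI[of _ "\<lambda>w. - q w * ?J w"] analytic_intros)
  moreover have "\<forall>\<^sub>F w in nhds 0. w \<noteq> 0 \<longrightarrow> h (F w) * deriv F w / F w = (?J w * h w + k w) / w"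
    using deriv_factored[OF a(1) F] F q(2) eventually_analytic_nonzero[OF a]
  proof eventually_elim
    case (elim w)
    have "h (F w) = h w - (w - F w) * q w"
      using elim by (simp add: algebra_simps)
    \<comment> \<open>Stated for arbitrary \<open>j\<close>, so that the fraction inside
      \<open>?J w\<close> stays closed.\<close>
    moreover have "j * x + (w - y) * (- q w * j) = j * (x - (w - y) * q w)" for j x y
      by (simp add: algebra_simps)
    ultimately have "?J w * h w + k w = ?J w * h (F w)"
      by (simp only: k_def)
    then show ?case
      using elim by (auto simp: field_simps)
  qed
  ultimately show "\<exists>k\<in>fixed_point_ideal F. \<forall>\<^sub>F w in at 0.
      h (F w) * deriv F w / F w = (?J w * h w + k w) / w"
    unfolding eventually_at_filter by auto
qed

text \<open>Two representatives \<open>J\<close> differ by a multiple of \<open>w - F w\<close>,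
  which changes the quotient only by a holomorphic function. The result is therefore the same for
  all of them.\<close>

lemma grothendieck_residue_log_jacobian:
  assumes a: "a analytic_on {0}" "a 0 \<noteq> 0"
    and F: "\<forall>\<^sub>F w in nhds 0. F w = w * a w" and neq: "\<forall>\<^sub>F w in at 0. F w \<noteq> w"
    and J: "log_jacobian F J"
  shows "grothendieck_residue (\<lambda>w. 1 - J w) (\<lambda>w. w - F w) = of_int (zorder (\<lambda>w. 1 - a w) 0)"
proof -
  \<comment> \<open>Testing the pull-back on the generator \<open>dw / w\<close>, that is on
    \<open>h = 1\<close>, already determines \<open>J\<close> modulo the ideal.\<close>
  have "(\<lambda>_. 1) analytic_on {0::complex}"
    by (intro analytic_intros)
  then obtain k where k: "k \<in> fixed_point_ideal F"
    "\<forall>\<^sub>F w in at 0. deriv F w / F w = (J w + k w) / w"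
    using J unfolding log_jacobian_def by fastforce
  then obtain q where q: "q analytic_on {0}" "\<forall>\<^sub>F w in nhds 0. k w = (w - F w) * q w"
    unfolding fixed_point_ideal_def by auto
  define b where "b = (\<lambda>w. 1 - a w)"
  have b: "b analytic_on {0}"
    unfolding b_def using a by (intro analytic_intros)
  have a_nz: "\<forall>\<^sub>F w in nhds 0. a w \<noteq> 0"
    using a by (rule eventually_analytic_nonzero)
  have ne: "\<forall>\<^sub>F w in at 0. w \<noteq> 0 \<and> F w = w * a w \<and> F w \<noteq> w \<and> a w \<noteq> 0 
       \<and> deriv F w = a w + w * deriv a w \<and> k w = (w - F w) * q w"
    using F neq a_nz deriv_factored[OF a(1) F] q(2)
    unfolding eventually_at_filter by eventually_elim auto
  have b_nz: "\<forall>\<^sub>F w in at 0. b w \<noteq> 0"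
    using ne by eventually_elim (auto simp: b_def)
  have "\<forall>\<^sub>F w in at 0. a analytic_on {w}"
    using isolated_singularity_at_analytic[OF a(1)] by (simp add: isolated_singularity_at_altdef)
  then have b': "\<forall>\<^sub>F w in at 0. deriv b w = - deriv a w"
    unfolding b_def by eventually_elim (auto intro!: DERIV_imp_deriv derivative_eq_intros
        analytic_derivI)
  \<comment> \<open>Obtained from \<open>- a' / (a * b) + q\<close> by splitting
    \<open>1 / (a * b)\<close> as \<open>1 / a + 1 / b\<close>, valid because
    \<open>a + b = 1\<close>, and by \<open>b' = - a'\<close>.\<close>
  define R where "R = (\<lambda>w. deriv b w / b w - (deriv a w / a w - q w))"
  have "\<forall>\<^sub>F w in at 0. (1 - J w) / (w - F w) = R w"
    using ne k(2) b' b_nz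
  proof eventually_elim
    case (elim w)
    have "(a w + w * deriv a w) / (w * a w) = (J w + k w) / w"
      using elim by simp
    then have "J w + k w = 1 + w * deriv a w / a w"
      using elim by (simp add: divide_simps)
    then have J: "J w = 1 + w * deriv a w / a w - (w - F w) * q w"
      using elim by (simp add: algebra_simps)
    have wF: "w - F w = w * b w"
      using elim by (simp add: b_def algebra_simps)
    have ab: "a w = 1 - b w"
      by (simp add: b_def)
    show ?case
      using elim unfolding R_def J wF by (simp add: ab field_simps)
  qed
  then have "grothendieck_residue (\<lambda>w. 1 - J w) (\<lambda>w. w - F w) = residue R 0"
    unfolding grothendieck_residue_def by (intro residue_cong) auto
  also have "\<dots> = of_int (zorder b 0)"
  proof -
    have "isolated_singularity_at R 0"
      unfolding R_def using b_nz a
      by (intro singularity_intros isolated_singularity_at_analytic not_essential_analytic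
          analytic_intros analytic_deriv b q) auto
    then obtain r where r: "r > 0" "R analytic_on ball 0 r - {0}"
      by (auto simp: isolated_singularity_at_def)
    \<comment> \<open>The factor \<open>w\<close> kills the holomorphic part in the limit; at a pole
      of order at most one, the limit of \<open>R w * w\<close> is the residue.\<close>
    have "(\<lambda>w. w * deriv b w / b w - w * (deriv a w / a w - q w)) \<midarrow>0\<rightarrow>
          of_int (zorder b 0) - 0 * (deriv a 0 / a 0 - q 0)"
      using a by (intro tendsto_intros tendsto_logderiv_zorder b b_nz
          isContD[OF analytic_at_imp_isCont] analytic_deriv q) auto
    then have "(\<lambda>w. R w * (w - 0)) \<midarrow>0\<rightarrow> of_int (zorder b 0)"
      by (simp add: R_def algebra_simps)
    then show ?thesis
      using r by (intro residue_simple'[of "ball 0 r"]) (auto intro: analytic_imp_holomorphic)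
  qed
  finally show ?thesis
    unfolding b_def .
qed

section \<open>Invariance of the order under conjugation\<close>

text \<open>Computing \<open>T w - F' (T w)\<close> in two ways gives
  \<open>w * t w * (1 - a' (T w)) = w * (1 - a w) * q w\<close>, where the divided differences
  \<open>t\<close> and \<open>q\<close> are units at \<open>0\<close>. Composition with
  \<open>T\<close> preserves the order because \<open>T\<close> has a simple zero.\<close>

lemma zorder_conjugate:
  assumes T: "T analytic_on {0}" "T 0 = 0" "deriv T 0 \<noteq> 0"
    and a: "a analytic_on {0}" "\<forall>\<^sub>F w in nhds 0. F w = w * a w"
    and a': "a' analytic_on {0}" "\<forall>\<^sub>F w in nhds 0. F' w = w * a' w"
    and neq: "\<forall>\<^sub>F w in at 0. F w \<noteq> w"
    and neq': "\<forall>\<^sub>F w in at 0. F' w \<noteq> w"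
    and conj: "\<forall>\<^sub>F w in nhds 0. F' (T w) = T (F w)"
  shows "zorder (\<lambda>w. 1 - a' w) 0 = zorder (\<lambda>w. 1 - a w) 0"
proof -
  have F: "F analytic_on {0}"
    using a by (subst analytic_at_cong[OF a(2) refl]) (intro analytic_intros)
  have F0: "F 0 = 0"
    using eventually_nhds_x_imp_x[OF a(2)] by simp
  obtain q where q: "q analytic_on {0}" "q 0 = deriv T 0"
    "\<forall>\<^sub>F w in nhds 0. T w - T (F w) = (w - F w) * q w"
    using divided_difference[OF T(1) F F0 neq] .
  \<comment> \<open>The zero map in the role of \<open>F\<close>: its divided difference gives the
    factorization \<open>T w = w * t w\<close>.\<close>
  have "\<forall>\<^sub>F w in at 0. (0::complex) \<noteq> w"
    by (auto simp: eventually_at_filter)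
  then obtain t where t: "t analytic_on {0}" "t 0 = deriv T 0" "\<forall>\<^sub>F w in nhds 0. T w = w * t w"
    using divided_difference[OF T(1), of "\<lambda>_. 0"] T(2) by auto
  have t_nz: "\<forall>\<^sub>F w in nhds 0. t w \<noteq> 0" and q_nz: "\<forall>\<^sub>F w in nhds 0. q w \<noteq> 0"
    using t q T(3) by (auto intro: eventually_analytic_nonzero)
  have Tlim: "(T \<longlongrightarrow> 0) (nhds 0)"
    using analytic_at_imp_isCont[OF T(1)] T(2) by (simp add: isCont_def tendsto_nhds_iff)
  have T_nz: "\<forall>\<^sub>F w in at 0. T w \<noteq> T 0"
    using t_nz t(3) unfolding eventually_at_filter by eventually_elim (auto simp: T)
  have a'_neq: "\<forall>\<^sub>F w in at 0. 1 - a' w \<noteq> 0"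
    using a'(2) neq' unfolding eventually_at_filter by eventually_elim auto
  have a_neq: "\<forall>\<^sub>F w in at 0. 1 - a w \<noteq> 0"
    using a(2) neq unfolding eventually_at_filter by eventually_elim auto
  have an: "(\<lambda>w. 1 - a' w) analytic_on {0}"
    using a' by (intro analytic_intros)
  have zT: "zorder T 0 = 1"
    using T by (intro zorder_zero_eqI') auto
  have "zorder ((\<lambda>w. 1 - a' w) \<circ> T) 0 = zorder (\<lambda>w. 1 - a' w) (T 0) * zorder (\<lambda>w. T w - T 0) 0"
    using T an a'_neq T_nz by (intro zorder_compose') 
      (auto intro: isolated_singularity_at_analytic not_essential_analytic)
  then have "zorder (\<lambda>w. 1 - a' w) 0 = zorder (\<lambda>w. 1 - a' (T w)) 0"
    using zT T by (simp add: o_def)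
  also have "\<dots> = zorder (\<lambda>w. (1 - a w) * (q w / t w)) 0"
  proof (rule zorder_cong[OF _ refl])
    have "\<forall>\<^sub>F w in nhds 0. F' (T w) = T w * a' (T w)"
      using Tlim a'(2) by (rule eventually_compose_filterlim[rotated])
    then show "\<forall>\<^sub>F w in at 0. 1 - a' (T w) = (1 - a w) * (q w / t w)"
      using conj a(2) t(3) q(3) t_nz unfolding eventually_at_filter
    proof eventually_elim
      case (elim w)
      have "w * t w * (1 - a' (T w)) = T w - F' (T w)"
        using elim by (simp add: right_diff_distrib)
      also have "\<dots> = (w - F w) * q w"
        using elim by simp
      also have "\<dots> = w * (1 - a w) * q w"
        using elim by (simp add: right_diff_distrib)
      finally have "w \<noteq> 0 \<Longrightarrow> t w * (1 - a' (T w)) = (1 - a w) * q w"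
        by simp
      then show ?case
        using elim by (simp add: eq_divide_eq mult.commute del: mult_cancel_left mult_cancel_right)
    qed
  qed
  also have "\<dots> = zorder (\<lambda>w. 1 - a w) 0 + zorder (\<lambda>w. q w / t w) 0"
  proof (rule zorder_times_analytic)
    show "(\<lambda>w. 1 - a w) analytic_on {0}" "(\<lambda>w. q w / t w) analytic_on {0}"
      using a q t T(3) by (auto intro!: analytic_intros)
    show "\<forall>\<^sub>F w in at 0. (1 - a w) * (q w / t w) \<noteq> 0"
      using a_neq t_nz q_nz unfolding eventually_at_filter by eventually_elim auto
  qed
  \<comment> \<open>Both \<open>q\<close> and \<open>t\<close> take the value
    \<open>deriv T 0\<close> at \<open>0\<close>, which is nonzero.\<close>
  also have "zorder (\<lambda>w. q w / t w) 0 = 0"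
    using q t T(3) by (intro zorder_eq_0I analytic_intros) auto
  finally show ?thesis
    by simp
qed


section \<open>Passing between germs at \<open>p\<close> and germs at \<open>0\<close> in a
  coordinate\<close>

lemma chart_open_image:
  assumes "chart U z" "open S" "S \<subseteq> U"
  shows "open (z ` S)"
proof -
  have "openin (top_of_set (z ` U)) (z ` S)"
    using assms unfolding chart_def
    by (intro homeomorphism_imp_open_map[of U "z ` U" z "inv_into U z"]) (auto simp: openin_open_eq)
  then show ?thesis
    using assms by (auto simp: chart_def openin_open_eq)
qed

lemma chart_inv_into:
  assumes "chart U z"
  shows "x \<in> U \<Longrightarrow> inv_into U z (z x) = x"
    and "w \<in> z ` U \<Longrightarrow> z (inv_into U z w) = w"
  using assms unfolding chart_def by (blast intro: homeomorphism_apply1 homeomorphism_apply2)+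

lemma coordinate_atD:
  assumes "coordinate_at A p U z"
  shows "chart U z" and "p \<in> U" and "z p = 0"
  using assms unfolding coordinate_at_def by blast+

lemma coordinate_at_inv_into:
  assumes "coordinate_at A p U z"
  shows "inv_into U z 0 = p" and "(inv_into U z \<longlongrightarrow> p) (nhds 0)"
    and "\<forall>\<^sub>F w in nhds 0. w \<in> z ` U"
proof -
  have U: "chart U z" "p \<in> U" "z p = 0" "open (z ` U)"
    using coordinate_atD[OF assms] by (simp_all add: chart_def)
  then have 0: "0 \<in> z ` U"
    by force
  show p: "inv_into U z 0 = p"
    using chart_inv_into(1)[of U z p] U by simp
  have "isCont (inv_into U z) 0"
    using U 0 by (auto simp: chart_def homeomorphism_def continuous_on_eq_continuous_at)
  then show "(inv_into U z \<longlongrightarrow> p) (nhds 0)"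
    using p by (metis isCont_def tendsto_at_iff_tendsto_nhds)
  show "\<forall>\<^sub>F w in nhds 0. w \<in> z ` U"
    using U(4) 0 by (rule eventually_nhds_in_open)
qed

lemma eventually_coordinate_inv_into:
  assumes z: "coordinate_at A p U z" and P: "\<forall>\<^sub>F x in nhds p. P x"
  shows "\<forall>\<^sub>F w in nhds 0. P (inv_into U z w)"
  using P coordinate_at_inv_into(2)[OF z] by (rule eventually_compose_filterlim)

lemma eventually_nhds_coordinate:
  assumes "coordinate_at A p U z"
  shows "\<forall>\<^sub>F x in nhds p. x \<in> U"
  using coordinate_atD(1,2)[OF assms] unfolding chart_def by (blast intro: eventually_nhds_in_open)

lemma eventually_nhds_fixed_coordinate:
  fixes f :: "'a::topological_space \<Rightarrow> 'a"
  assumes z: "coordinate_at A p U z" and f: "continuous_on UNIV f" "f p = p"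
  shows "\<forall>\<^sub>F x in nhds p. f x \<in> U"
proof -
  have "(f \<longlongrightarrow> p) (nhds p)"
    using f by (metis UNIV_I continuous_on_def tendsto_at_iff_tendsto_nhds)
  with eventually_nhds_coordinate[OF z] show ?thesis
    by (rule eventually_compose_filterlim)
qed

text \<open>A fixed point in the coordinate comes from one of \<open>f\<close> only where
  \<open>f x\<close> stays in \<open>U\<close>, since \<open>z\<close> is injective just there.
  Continuity of \<open>f\<close> at the fixed point \<open>p\<close> ensures this nearby.\<close>

lemma in_coordinate_neq:
  fixes f :: "'a::topological_space \<Rightarrow> 'a"
  assumes z: "coordinate_at A p U z" and f: "continuous_on UNIV f" "isolated_fixed_point f p"
  shows "\<forall>\<^sub>F w in at 0. in_coordinate U z f w \<noteq> w"
proof -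
  have fp: "f p = p" "\<forall>\<^sub>F x in nhds p. x \<noteq> p \<longrightarrow> f x \<noteq> x"
    using f by (auto simp: isolated_fixed_point_def eventually_at_filter)
  note U = coordinate_atD(1,3)[OF z]
  show ?thesis
    using eventually_coordinate_inv_into[OF z eventually_nhds_fixed_coordinate[OF z f(1) fp(1)]]
      eventually_coordinate_inv_into[OF z fp(2)] coordinate_at_inv_into(3)[OF z]
    unfolding eventually_at_filter
  proof eventually_elim
    case (elim w)
    show ?case
    proof (intro impI notI)
      assume w: "w \<noteq> 0" "in_coordinate U z f w = w"
      have "inv_into U z w \<noteq> p"
        using elim(3) w(1) U chart_inv_into(2)[OF U(1), of w] by auto
      moreover have "f (inv_into U z w) = inv_into U z w"
        using elim(1) w(2) chart_inv_into(1)[OF U(1)] by (metis comp_apply in_coordinate_def)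
      ultimately show False
        using elim(2) by simp
    qed
  qed
qed

section \<open>Transition maps and the change of coordinate\<close>

text \<open>Compatibility relates \<open>z\<close> and \<open>y\<close> only to the charts of
  \<open>A\<close>, not to each other, so the transition map is factored through a chart of
  \<open>A\<close> around \<open>p\<close>.\<close>

lemma transition_analytic:
  assumes A: "complex_curve A" and z: "coordinate_at A p U z" and y: "coordinate_at A p V y"
  shows "(y \<circ> inv_into U z) analytic_on {0}"
proof -
  obtain W \<psi> where W: "(W, \<psi>) \<in> A" "p \<in> W"
    using A by (force simp: complex_curve_def)
  have \<psi>: "chart W \<psi>"
    using A W by (auto simp: complex_curve_def)
  have U: "chart U z" "p \<in> U" "z p = 0" "compatible U z W \<psi>"
    and V: "chart V y" "p \<in> V" "compatible V y W \<psi>"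
    using z y W by (auto simp: coordinate_at_def)
  \<comment> \<open>The region where all three charts are defined and the factorization through
    \<open>\<psi>\<close> is valid.\<close>
  define M where "M = z ` (U \<inter> W \<inter> V)"
  have "open M"
    unfolding M_def using U(1) \<psi> V(1) by (intro chart_open_image) (auto simp: chart_def)
  have "0 \<in> M"
    unfolding M_def using U W V by force
  have "(\<psi> \<circ> inv_into U z) holomorphic_on M" "(y \<circ> inv_into W \<psi>) holomorphic_on \<psi> ` (V \<inter> W)"
    using U(4) V(3) by (auto simp: compatible_def M_def elim: holomorphic_on_subset)
  moreover have "(\<psi> \<circ> inv_into U z) ` M \<subseteq> \<psi> ` (V \<inter> W)"
    using U(1) by (auto simp: M_def chart_inv_into)
  ultimately have "((y \<circ> inv_into W \<psi>) \<circ> (\<psi> \<circ> inv_into U z)) holomorphic_on M"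
    by (intro holomorphic_on_compose_gen)
  moreover have "((y \<circ> inv_into W \<psi>) \<circ> (\<psi> \<circ> inv_into U z)) w = (y \<circ> inv_into U z) w" if "w \<in> M" for w
    using that U(1) \<psi> by (auto simp: M_def chart_inv_into)
  ultimately have "(y \<circ> inv_into U z) holomorphic_on M"
    using holomorphic_cong by blast
  then show ?thesis
    using \<open>open M\<close> \<open>0 \<in> M\<close> by (auto simp: analytic_at)
qed

lemma transition_inverse:
  assumes z: "coordinate_at A p U z" and y: "coordinate_at A p V y"
  shows "\<forall>\<^sub>F w in nhds 0. (z \<circ> inv_into V y) ((y \<circ> inv_into U z) w) = w"
  using eventually_coordinate_inv_into[OF z eventually_nhds_coordinate[OF y]]
    coordinate_at_inv_into(3)[OF z]
proof eventually_elim
  case (elim w)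
  then show ?case
    using coordinate_atD[OF z] chart_inv_into(2)[of U z] coordinate_atD[OF y]
      chart_inv_into(1)[of V y] by simp
qed

text \<open>The chain rule for the transition map and its local inverse: their derivatives at
  \<open>0\<close> have product \<open>1\<close>.\<close>

lemma transition_deriv_nonzero:
  assumes A: "complex_curve A" and z: "coordinate_at A p U z" and y: "coordinate_at A p V y"
  shows "deriv (y \<circ> inv_into U z) 0 \<noteq> 0"
proof -
  let ?T = "y \<circ> inv_into U z" and ?S = "z \<circ> inv_into V y"
  have T0: "?T 0 = 0"
    using coordinate_atD(3)[OF y] coordinate_at_inv_into(1)[OF z] by simp
  have "(?T has_field_derivative deriv ?T 0) (at 0)" "(?S has_field_derivative deriv ?S 0) (at (?T 0))"
    unfolding T0 using transition_analytic A z y by (auto intro!: analytic_derivI)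
  then have "((?S \<circ> ?T) has_field_derivative deriv ?S 0 * deriv ?T 0) (at 0)"
    by (rule DERIV_chain[rotated])
  moreover have "((?S \<circ> ?T) has_field_derivative 1) (at 0)"
    using transition_inverse[OF z y] by (subst DERIV_cong_ev[OF refl _ refl, of _ "\<lambda>w. w"]) auto
  ultimately have "deriv ?S 0 * deriv ?T 0 = 1"
    by (rule DERIV_unique)
  then show ?thesis
    by auto
qed

lemma in_coordinate_transition:
  fixes f :: "'a::topological_space \<Rightarrow> 'a"
  assumes z: "coordinate_at A p U z" and y: "coordinate_at A p V y"
    and f: "continuous_on UNIV f" "f p = p"
  shows "\<forall>\<^sub>F w in nhds 0. in_coordinate V y f ((y \<circ> inv_into U z) w)
       = (y \<circ> inv_into U z) (in_coordinate U z f w)"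
  using eventually_coordinate_inv_into[OF z eventually_nhds_coordinate[OF y]]
    eventually_coordinate_inv_into[OF z eventually_nhds_fixed_coordinate[OF z f]]
proof eventually_elim
  case (elim w)
  then show ?case
    using chart_inv_into(1)[OF coordinate_atD(1)[OF z]] chart_inv_into(1)[OF coordinate_atD(1)[OF y]]
    by (simp add: in_coordinate_def)
qed

text \<open>The value \<open>a 0\<close> is the multiplier of \<open>f\<close> at \<open>p\<close>,
  hence independent of the coordinate. In particular \<open>a' 0\<close> is nonzero when
  \<open>a 0\<close> is, as the residue computation in the new coordinate requires.\<close>

lemma in_coordinate_factored:
  fixes f :: "'a::{t2_space, second_countable_topology} \<Rightarrow> 'a"
  assumes A: "complex_curve A" and z: "coordinate_at A p U z" and y: "coordinate_at A p V y"
    and f: "continuous_on UNIV f" "f p = p"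
    and a: "a analytic_on {0}" "\<forall>\<^sub>F w in nhds 0. in_coordinate U z f w = w * a w"
  obtains a' where "a' analytic_on {0}" "\<forall>\<^sub>F w in nhds 0. in_coordinate V y f w = w * a' w"
    "a' 0 = a 0"
proof -
  let ?T = "y \<circ> inv_into U z" and ?S = "z \<circ> inv_into V y"
  let ?F = "in_coordinate U z f" and ?F' = "in_coordinate V y f"
  have T: "?T analytic_on {0}" and S: "?S analytic_on {0}"
    using transition_analytic A z y by blast+
  have T0: "?T 0 = 0" and S0: "?S 0 = 0" and F'0: "?F' 0 = 0"
    using coordinate_atD(3)[OF y] coordinate_atD(3)[OF z] coordinate_at_inv_into(1)[OF z]
      coordinate_at_inv_into(1)[OF y] f(2) by (simp_all add: in_coordinate_def)
  have F: "?F analytic_on {0}"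
    using a by (subst analytic_at_cong[OF a(2) refl]) (intro analytic_intros)
  have F0: "?F 0 = 0"
    using eventually_nhds_x_imp_x[OF a(2)] by simp
  have Slim: "(?S \<longlongrightarrow> 0) (nhds 0)"
    using analytic_at_imp_isCont[OF S] S0 by (simp only: isCont_def tendsto_nhds_iff)
  \<comment> \<open>Conjugation by the transition map transfers analyticity from \<open>?F\<close>
    to \<open>?F'\<close>.\<close>
  have eq: "\<forall>\<^sub>F w in nhds 0. ?F' w = ?T (?F (?S w))"
    using transition_inverse[OF y z]
      eventually_compose_filterlim[OF in_coordinate_transition[OF z y f] Slim]
    by eventually_elim simp
  have FS: "(?F \<circ> ?S) analytic_on {0}"
    using S0 by (intro analytic_on_compose_gen[OF S F]) simp
  have F': "?F' analytic_on {0}"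
  proof (subst analytic_at_cong[OF eq refl])
    have "(?T \<circ> (?F \<circ> ?S)) analytic_on {0}"
      using F0 S0 by (intro analytic_on_compose_gen[OF FS T]) simp
    then show "(\<lambda>w. ?T (?F (?S w))) analytic_on {0}"
      by (simp add: o_def)
  qed
  have "\<forall>\<^sub>F w in at 0. (0::complex) \<noteq> w"
    by (auto simp: eventually_at_filter)
  then obtain a' where a': "a' analytic_on {0}" "a' 0 = deriv ?F' 0"
    "\<forall>\<^sub>F w in nhds 0. ?F' w = w * a' w"
    using divided_difference[OF F', of "\<lambda>_. 0"] F'0 by auto
  have dF: "deriv ?F 0 = a 0"
    using eventually_nhds_x_imp_x[OF deriv_factored[OF a]] by simp
  have dT: "(?T has_field_derivative deriv ?T 0) (at 0)"
    and dF: "(?F has_field_derivative a 0) (at 0)"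
    and dF': "(?F' has_field_derivative a' 0) (at 0)"
    using analytic_derivI[OF T] analytic_derivI[OF F] analytic_derivI[OF F'] dF a'(2) by auto
  \<comment> \<open>Differentiating both sides of the conjugation relation at \<open>0\<close> and
    cancelling \<open>deriv ?T 0\<close> gives \<open>a' 0 = a 0\<close>.\<close>
  have "((?F' \<circ> ?T) has_field_derivative a' 0 * deriv ?T 0) (at 0)"
    using dT dF' T0 by (intro DERIV_chain) simp_all
  moreover have "((?T \<circ> ?F) has_field_derivative deriv ?T 0 * a 0) (at 0)"
    using dT dF F0 by (intro DERIV_chain) simp_all
  moreover have "\<forall>\<^sub>F w in nhds 0. (?F' \<circ> ?T) w = (?T \<circ> ?F) w"
    using in_coordinate_transition[OF z y f] by (simp only: comp_apply)
  ultimately have "a' 0 * deriv ?T 0 = deriv ?T 0 * a 0"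
    using DERIV_cong_ev[OF refl _ refl] DERIV_unique by blast
  then have "a' 0 = a 0"
    using transition_deriv_nonzero[OF A z y] by simp
  with a' that show thesis
    by blast
qed

theorem proposition9p1:
  fixes A :: "('a::{t2_space, second_countable_topology}) atlas"
    and p :: 'a and f :: "'a \<Rightarrow> 'a"
    and U :: "'a set" and z :: "'a \<Rightarrow> complex" and a :: "complex \<Rightarrow> complex"
  assumes "complex_curve A"
    and "strict_log_self_map A {p} f"
    and "coordinate_at A p U z"
    and "a analytic_on {0}"
    and "\<forall>\<^sub>F w in nhds 0. in_coordinate U z f w = w * a w"
    and "a 0 \<noteq> 0"
    and "isolated_fixed_point f p"
  shows "dR_log_index A p f = of_int (zorder (\<lambda>w. 1 - a w) 0)"
  unfolding dR_log_index_def
proof (rule the_equality)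
  note A = assms(1) and z = assms(3) and a = assms(4,6) and F = assms(5)
  have f: "continuous_on UNIV f" "f p = p"
    using assms(2,7) by (auto simp: strict_log_self_map_def holomorphic_self_map_def
        isolated_fixed_point_def)
  have neq: "\<forall>\<^sub>F w in at 0. in_coordinate V y f w \<noteq> w" if "coordinate_at A p V y" for V y
    using that f(1) assms(7) by (rule in_coordinate_neq)
  let ?index = "\<lambda>V y J. grothendieck_residue (\<lambda>w. 1 - J w) (\<lambda>w. w - in_coordinate V y f w)"
  \<comment> \<open>Existence of the described value: the given coordinate with the explicit
    representative of the Jacobian.\<close>
  let ?J = "\<lambda>w. 1 + w * deriv a w / a w"
  have J: "log_jacobian (in_coordinate U z f) ?J"
    using a F neq[OF z] by (rule log_jacobian_exists)
  moreover have "of_int (zorder (\<lambda>w. 1 - a w) 0) = ?index U z ?J"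
    using grothendieck_residue_log_jacobian[OF a F neq[OF z] J] by simp
  ultimately show "\<exists>V y J. coordinate_at A p V y \<and> log_jacobian (in_coordinate V y f) J \<and>
      of_int (zorder (\<lambda>w. 1 - a w) 0) = ?index V y J"
    using z by blast
  \<comment> \<open>Uniqueness: any coordinate \<open>y\<close> and any representative
    \<open>J\<close> give the order of \<open>1 - a'\<close>, which conjugation by the transition
    map identifies with that of \<open>1 - a\<close>.\<close>
  fix r
  assume "\<exists>V y J. coordinate_at A p V y \<and> log_jacobian (in_coordinate V y f) J \<and> r = ?index V y J"
  then obtain V y J where y: "coordinate_at A p V y"
    and J: "log_jacobian (in_coordinate V y f) J" and r: "r = ?index V y J"
    by blast
  obtain a' where a': "a' analytic_on {0}"
    "\<forall>\<^sub>F w in nhds 0. in_coordinate V y f w = w * a' w" "a' 0 = a 0"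
    using in_coordinate_factored[OF A z y f a(1) F] .
  have "r = of_int (zorder (\<lambda>w. 1 - a' w) 0)"
    unfolding r using a' a(2) neq[OF y] J by (intro grothendieck_residue_log_jacobian) auto
  also have "zorder (\<lambda>w. 1 - a' w) 0 = zorder (\<lambda>w. 1 - a w) 0"
  proof (rule zorder_conjugate[OF transition_analytic[OF A z y] _
        transition_deriv_nonzero[OF A z y] a(1) F a'(1,2) neq[OF z] neq[OF y]
        in_coordinate_transition[OF z y f]])
    show "(y \<circ> inv_into U z) 0 = 0"
      using coordinate_atD(3)[OF y] coordinate_at_inv_into(1)[OF z] by simp
  qed
  finally show "r = of_int (zorder (\<lambda>w. 1 - a w) 0)" .
qed

end
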